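(* Let $k,\ell\ge1$. A function $f:\mathbb{N}^k\to\mathbb{N}^\ell$ can be computed by a recurrent finite abelian processor if and only if all of the following hold: (i) $f(\mathbf{0})=\mathbf{0}$; (ii) $f$ is increasing; (iii) $f=L+P$ for a linear function $L:\mathbb{N}^k\to\mathbb{Q}^\ell$ and a periodic function $P:\mathbb{N}^k\to\mathbb{Q}^\ell$.
   Context: $\mathbb{N}=\{0,1,2,\dots\}$. A processor with finite input alphabet $A$, finite output alphabet $B$ and finite state space $Q$ consists of transition maps $t_i:Q\to Q$ and output maps $o_i:Q\to\mathbb{N}^B$ ($i\in A$): on receiving letter $i$ in state $q$ it moves to $t_i(q)$ and emits $(o_i(q))_b$ copies of letter $b$. It is abelian if $t_it_j=t_jt_i$ and $o_i+o_j\circ t_i=o_j+o_i\circ t_j$ for all $i,j\in A$. Every processor has an initial state $q^0$ from which every state is reachable by compositions of transition maps. It computes $F:\mathbb{N}^A\to\mathbb{N}^B$, where $F(\mathbf{x})$ is the total output when, from $q^0$, it receives $x_a$ letters $a$ for each $a$ (order-independent); here $|A|=k$, $|B|=\ell$. It is recurrent if for every pair of states $q,q'$ some finite sequence of input letters takes it from $q$ to $q'$. $f$ is increasing if $\mathbf{x}\le\mathbf{y}$ coordinatewise implies $f(\mathbf{x})\le f(\mathbf{y})$. $P$ is periodic if there is a subgroup $\Lambda\subset\mathbb{Z}^k$ of finite index with $P(\mathbf{x})=P(\mathbf{y})$ whenever $\mathbf{x}-\mathbf{y}\in\Lambda$. *)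

theory Defs
  imports "HOL-Analysis.Analysis" "HOL-Algebra.Coset"
begin

text \<open>
  \<open>\<nat>\<^sup>k\<close> is \<^typ>\<open>nat ^ 'a\<close> and \<open>\<nat>\<^sup>\<ell>\<close> is \<^typ>\<open>nat ^ 'b\<close>, where the finite (hence nonempty) index
  types \<^typ>\<open>'a\<close> and \<^typ>\<open>'b\<close> also serve as the input and output alphabets. The order on
  these types is the coordinatewise one.
  The maps of a processor only matter on its set of states.
\<close>

record ('q, 'a::finite, 'b::finite) processor =
  states :: "'q set"
  transition :: "'a \<Rightarrow> 'q \<Rightarrow> 'q"
  emission :: "'a \<Rightarrow> 'q \<Rightarrow> nat ^ 'b"
  initial :: 'q

primrec final_state :: "('q, 'a::finite, 'b::finite) processor \<Rightarrow> 'q \<Rightarrow> 'a list \<Rightarrow> 'q" where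
  "final_state M q [] = q"
| "final_state M q (i # w) = final_state M (transition M i q) w"

primrec total_output :: "('q, 'a::finite, 'b::finite) processor \<Rightarrow> 'q \<Rightarrow> 'a list \<Rightarrow> nat ^ 'b" where
  "total_output M q [] = 0"
| "total_output M q (i # w) = emission M i q + total_output M (transition M i q) w"

definition finite_processor :: "('q, 'a::finite, 'b::finite) processor \<Rightarrow> bool" where
  "finite_processor M \<longleftrightarrow>
     finite (states M) \<and> initial M \<in> states M \<and>
     (\<forall>i. \<forall>q \<in> states M. transition M i q \<in> states M) \<and>
     (\<forall>q \<in> states M. \<exists>w. final_state M (initial M) w = q)"

definition abelian_processor :: "('q, 'a::finite, 'b::finite) processor \<Rightarrow> bool" where
  "abelian_processor M \<longleftrightarrow>
     (\<forall>i j. \<forall>q \<in> states M.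
        transition M i (transition M j q) = transition M j (transition M i q) \<and>
        emission M i q + emission M j (transition M i q) =
        emission M j q + emission M i (transition M j q))"

definition recurrent_processor :: "('q, 'a::finite, 'b::finite) processor \<Rightarrow> bool" where
  "recurrent_processor M \<longleftrightarrow>
     (\<forall>q \<in> states M. \<forall>q' \<in> states M. \<exists>w. final_state M q w = q')"

definition letter_counts :: "('a::finite) list \<Rightarrow> nat ^ 'a" where
  "letter_counts w = (\<chi> a. count_list w a)"

text \<open>
  For an abelian processor the total output depends only on the letter counts; the
  definition asks that every ordering of the input produces the prescribed output.
\<close>

definition computes ::
    "('q, 'a::finite, 'b::finite) processor \<Rightarrow> (nat ^ 'a \<Rightarrow> nat ^ 'b) \<Rightarrow> bool" where
  "computes M F \<longleftrightarrow> (\<forall>w. total_output M (initial M) w = F (letter_counts w))"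

text \<open>
  HOL cannot quantify existentially over the type of states, so the state space is taken to be
  a finite set of natural numbers; \<open>computable_by_recurrentI\<close> below shows that
  this loses no generality.
\<close>

definition computable_by_recurrent :: "(nat ^ 'a::finite \<Rightarrow> nat ^ 'b::finite) \<Rightarrow> bool" where
  "computable_by_recurrent F \<longleftrightarrow>
     (\<exists>M :: (nat, 'a, 'b) processor.
        finite_processor M \<and> abelian_processor M \<and> recurrent_processor M \<and> computes M F)"

lemma computable_by_recurrentI:
  fixes M :: "('q, 'a::finite, 'b::finite) processor"
  assumes fin: "finite_processor M" and ab: "abelian_processor M"
    and rec: "recurrent_processor M" and comp: "computes M F"
  shows "computable_by_recurrent F"
proof -
  have "finite (states M)" and init: "initial M \<in> states M"
    and tr: "\<And>i q. q \<in> states M \<Longrightarrow> transition M i q \<in> states M"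
    and reach: "\<And>q. q \<in> states M \<Longrightarrow> \<exists>w. final_state M (initial M) w = q"
    using fin by (auto simp: finite_processor_def)
  from \<open>finite (states M)\<close> obtain h :: "'q \<Rightarrow> nat" where h: "inj_on h (states M)"
    using finite_imp_inj_to_nat_seg by blast
  define g where "g = inv_into (states M) h"
  have g: "g (h q) = q" if "q \<in> states M" for q
    using h that by (simp add: g_def)
  define N :: "(nat, 'a, 'b) processor" where
    "N = \<lparr>states = h ` states M, transition = (\<lambda>i n. h (transition M i (g n))),
          emission = (\<lambda>i n. emission M i (g n)), initial = h (initial M)\<rparr>"
  have N: "states N = h ` states M" "initial N = h (initial M)"
    "\<And>i n. transition N i n = h (transition M i (g n))"
    "\<And>i n. emission N i n = emission M i (g n)"
    by (simp_all add: N_def)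
  have fs: "final_state N (h q) w = h (final_state M q w)" if "q \<in> states M" for q w
    using that by (induction w arbitrary: q) (auto simp: N g tr)
  have ot: "total_output N (h q) w = total_output M q w" if "q \<in> states M" for q w
    using that by (induction w arbitrary: q) (auto simp: N g tr)
  have "finite_processor N"
    unfolding finite_processor_def N(1,2) using \<open>finite (states M)\<close> init tr reach fs
    by (auto simp: N(3) g) metis
  moreover have "abelian_processor N"
    using ab tr by (auto simp: abelian_processor_def N g)
  moreover have "recurrent_processor N"
    using rec fs unfolding recurrent_processor_def N(1) by (auto, metis)
  moreover have "computes N F"
    using comp ot init by (auto simp: computes_def N(2))
  ultimately show ?thesis
    unfolding computable_by_recurrent_def by blast
qed

definition of_nat_vec :: "nat ^ 'n::finite \<Rightarrow> ('c::semiring_1) ^ 'n" where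
  "of_nat_vec x = (\<chi> i. of_nat (x $ i))"

text \<open>Linear on \<open>\<nat>\<^sup>k\<close> means being the restriction of a \<open>\<rat>\<close>-linear map \<open>\<rat>\<^sup>k \<rightarrow> \<rat>\<^sup>\<ell>\<close>.\<close>

definition linear_on_nat_vec :: "(nat ^ 'a::finite \<Rightarrow> rat ^ 'b::finite) \<Rightarrow> bool" where
  "linear_on_nat_vec L \<longleftrightarrow>
     (\<exists>L' :: rat ^ 'a \<Rightarrow> rat ^ 'b.
        Vector_Spaces.linear (*s) (*s) L' \<and> (\<forall>x. L x = L' (of_nat_vec x)))"

definition int_vec_group :: "(int ^ 'a::finite) monoid" where
  "int_vec_group = \<lparr>carrier = UNIV, monoid.mult = (+), one = 0\<rparr>"

definition periodic :: "(nat ^ 'a::finite \<Rightarrow> 'c) \<Rightarrow> bool" where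
  "periodic P \<longleftrightarrow>
     (\<exists>\<Lambda> :: (int ^ 'a) set.
        subgroup \<Lambda> int_vec_group \<and> finite (rcosets\<^bsub>int_vec_group\<^esub> \<Lambda>) \<and>
        (\<forall>x y. of_nat_vec x - of_nat_vec y \<in> \<Lambda> \<longrightarrow> P x = P y))"

end

theory Submission
  imports Defs "HOL-Library.Multiset"
begin

text \<open>
  In a recurrent abelian processor some power \<open>m > 0\<close> of every letter returns the initial state
  to itself, so \<open>f (x + m e\<^sub>i) = f x + f (m e\<^sub>i)\<close>; subtracting the linear function with slopes
  \<open>f (m e\<^sub>i) / m\<close> leaves something periodic modulo \<open>m\<close>. Conversely, if \<open>f = L + P\<close> with \<open>P\<close>
  periodic modulo \<open>m\<close>, then the increments \<open>f (x + e\<^sub>i) - f x\<close> depend only on \<open>x\<close> modulo \<open>m\<close>, so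
  a processor whose state is the letter count modulo \<open>m\<close> can emit them.
\<close>

section \<open>Vectors and words\<close>

text \<open>Serves both finiteness claims about residues modulo \<open>m\<close>: that of the set of
  cosets and that of the state space.\<close>

lemma finite_vec_range:
  assumes "finite A"
  shows "finite {v :: 'c ^ 'a::finite. \<forall>i. v $ i \<in> A}"
proof -
  have "finite (PiE (UNIV :: 'a set) (\<lambda>_. A))"
    using assms by (simp add: finite_PiE)
  moreover have "{v :: 'c ^ 'a. \<forall>i. v $ i \<in> A} \<subseteq> vec_lambda ` PiE UNIV (\<lambda>_. A)"
  proof
    fix v :: "'c ^ 'a"
    assume "v \<in> {v. \<forall>i. v $ i \<in> A}"
    then have "vec_nth v \<in> PiE UNIV (\<lambda>_. A)"
      by auto
    then show "v \<in> vec_lambda ` PiE UNIV (\<lambda>_. A)"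
      by (metis image_eqI vec_nth_inverse)
  qed
  ultimately show ?thesis
    by (meson finite_imageI finite_subset)
qed

lemma axis_zero [simp]: "axis i 0 = 0"
  by (simp add: vec_eq_iff axis_def)

lemma sum_axis: "(\<Sum>i\<in>UNIV. axis i (c i)) = (\<chi> i. c i)"
  for c :: "'a::finite \<Rightarrow> 'c::comm_monoid_add"
  by (simp add: vec_eq_iff axis_def if_distrib[of "\<lambda>f. f _"] cong: if_cong)

lemma vec_le_add_diff: "x \<le> y \<Longrightarrow> x + (y - x) = y"
  for x y :: "nat ^ 'a::finite"
  by (simp add: less_eq_vec_def vec_eq_iff)

lemma of_nat_vec_add: "of_nat_vec (x + y) = of_nat_vec x + of_nat_vec y"
  by (simp add: of_nat_vec_def vec_eq_iff)

lemma of_nat_vec_nth [simp]: "of_nat_vec x $ i = of_nat (x $ i)"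
  by (simp add: of_nat_vec_def)

lemma of_nat_vec_eq_iff: "(of_nat_vec x :: 'c::semiring_char_0 ^ 'a::finite) = of_nat_vec y \<longleftrightarrow> x = y"
  by (simp add: vec_eq_iff)

lemma letter_counts_Nil [simp]: "letter_counts [] = 0"
  by (simp add: letter_counts_def vec_eq_iff)

lemma letter_counts_Cons: "letter_counts (i # w) = axis i 1 + letter_counts w"
  by (simp add: letter_counts_def vec_eq_iff axis_def)

lemma letter_counts_append: "letter_counts (v @ w) = letter_counts v + letter_counts w"
  by (simp add: letter_counts_def vec_eq_iff)

lemma letter_counts_replicate: "letter_counts (replicate n i) = axis i n"
  by (induction n) (auto simp: letter_counts_Cons vec_eq_iff axis_def)

text \<open>Transfers facts about words to arbitrary count vectors. The alphabet is finite, so any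
  count function is a multiset, and listing its elements gives the word.\<close>

lemma surj_letter_counts: "\<exists>w. letter_counts w = x"
proof -
  obtain w where "mset w = Abs_multiset (\<lambda>a. x $ a)"
    using ex_mset by blast
  then have "count_list w a = x $ a" for a
    by (metis count_mset count_Abs_multiset finite)
  then show ?thesis
    by (auto simp: letter_counts_def vec_eq_iff)
qed

section \<open>Subgroups of finite index in \<open>\<int>\<^sup>k\<close>\<close>

lemma int_vec_group_simps [simp]:
  "carrier int_vec_group = UNIV" "x \<otimes>\<^bsub>int_vec_group\<^esub> y = x + y" "\<one>\<^bsub>int_vec_group\<^esub> = 0"
  by (simp_all add: int_vec_group_def)

lemma group_int_vec_group: "group int_vec_group"
proof (rule groupI)
  fix x :: "int ^ 'a"
  show "\<exists>y\<in>carrier int_vec_group. y \<otimes>\<^bsub>int_vec_group\<^esub> x = \<one>\<^bsub>int_vec_group\<^esub>"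
    by (intro bexI[of _ "- x"]) simp_all
qed (simp_all add: add.assoc)

lemma inv_int_vec_group [simp]: "inv\<^bsub>int_vec_group\<^esub> x = - x"
  by (rule group.inv_equality[OF group_int_vec_group]) auto

lemma subgroup_int_vec_group_iff:
  "subgroup \<Lambda> int_vec_group \<longleftrightarrow> 0 \<in> \<Lambda> \<and> (\<forall>x\<in>\<Lambda>. \<forall>y\<in>\<Lambda>. x + y \<in> \<Lambda>) \<and> (\<forall>x\<in>\<Lambda>. - x \<in> \<Lambda>)"
  by (auto simp: subgroup_def)

text \<open>Repeated addition yields the natural multiples; negation then covers the negative
  ones.\<close>

lemma subgroup_contains_axis_multiples:
  assumes "subgroup \<Lambda> int_vec_group" "axis i p \<in> \<Lambda>" "p dvd c"
  shows "axis i c \<in> \<Lambda>"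
proof -
  have zero: "0 \<in> \<Lambda>" and add: "\<And>x y. x \<in> \<Lambda> \<Longrightarrow> y \<in> \<Lambda> \<Longrightarrow> x + y \<in> \<Lambda>"
    and neg: "\<And>x. x \<in> \<Lambda> \<Longrightarrow> - x \<in> \<Lambda>"
    using assms(1) by (auto simp: subgroup_int_vec_group_iff)
  have nat: "axis i (p * int n) \<in> \<Lambda>" for n
  proof (induction n)
    case 0
    then show ?case using zero by simp
  next
    case (Suc n)
    have "axis i (p * int (Suc n)) = axis i p + axis i (p * int n)"
      by (simp add: vec_eq_iff axis_def algebra_simps)
    then show ?case using add[OF assms(2) Suc] by simp
  qed
  have minus: "axis i (- d) = - axis i d" for d :: int
    by (simp add: vec_eq_iff axis_def)
  obtain k where "c = p * k"
    using assms(3) by blast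
  then show ?thesis
    using nat[of "nat k"] neg[OF nat[of "nat (- k)"]]
    by (cases "k \<ge> 0") (simp_all flip: minus)
qed

text \<open>Replaces an arbitrary period subgroup by a single modulus. Finite index puts some
  positive multiple of each unit vector into \<open>\<Lambda>\<close>; a common multiple of these
  then works in all coordinates.\<close>

lemma finite_index_contains_multiples:
  fixes \<Lambda> :: "(int ^ 'a::finite) set"
  assumes sub: "subgroup \<Lambda> int_vec_group" and fin: "finite (rcosets\<^bsub>int_vec_group\<^esub> \<Lambda>)"
  obtains m :: nat where "m > 0" "\<And>z. (\<And>i. int m dvd z $ i) \<Longrightarrow> z \<in> \<Lambda>"
proof -
  have zero: "0 \<in> \<Lambda>" and add: "\<And>x y. x \<in> \<Lambda> \<Longrightarrow> y \<in> \<Lambda> \<Longrightarrow> x + y \<in> \<Lambda>"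
    using sub by (auto simp: subgroup_int_vec_group_iff)
  have "\<exists>p::nat. p > 0 \<and> axis i (int p) \<in> \<Lambda>" for i
  proof -
    \<comment> \<open>Pigeonhole: infinitely many multiples of the unit vector lie in finitely many
      cosets, so two of them differ by an element of \<open>\<Lambda>\<close>.\<close>
    define coset where "coset n = \<Lambda> #>\<^bsub>int_vec_group\<^esub> axis i (int n)" for n
    have "range coset \<subseteq> rcosets\<^bsub>int_vec_group\<^esub> \<Lambda>"
      by (auto simp: coset_def RCOSETS_def)
    then have "\<not> inj coset"
      using fin finite_subset finite_imageD infinite_UNIV_nat by blast
    then obtain a b where "a < b" and "coset a = coset b"
      unfolding inj_def by (metis linorder_neqE_nat)
    have "axis i (int b) \<in> coset b"
      using zero by (force simp: coset_def r_coset_def)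
    then have "axis i (int b) \<in> coset a"
      using \<open>coset a = coset b\<close> by simp
    then obtain h where "h \<in> \<Lambda>" "axis i (int b) = h + axis i (int a)"
      unfolding coset_def r_coset_def by auto
    then have "h = axis i (int (b - a))"
      using \<open>a < b\<close> by (auto simp: vec_eq_iff axis_def of_nat_diff split: if_splits)
    then show ?thesis
      using \<open>h \<in> \<Lambda>\<close> \<open>a < b\<close> by (intro exI[of _ "b - a"]) auto
  qed
  then obtain p :: "'a \<Rightarrow> nat" where p: "\<And>i. p i > 0" "\<And>i. axis i (int (p i)) \<in> \<Lambda>"
    by metis
  show ?thesis
  proof (rule that[of "\<Prod>i\<in>UNIV. p i"])
    show "(\<Prod>i\<in>UNIV. p i) > 0"
      using p(1) by (simp add: prod_pos)
    fix z :: "int ^ 'a"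
    assume z: "\<And>i. int (\<Prod>i\<in>UNIV. p i) dvd z $ i"
    have "p i dvd (\<Prod>i\<in>UNIV. p i)" for i
      by (simp add: dvd_prodI)
    then have "int (p i) dvd z $ i" for i
      using z[of i] dvd_trans int_dvd_int_iff by blast
    then have "axis i (z $ i) \<in> \<Lambda>" for i
      using subgroup_contains_axis_multiples[OF sub p(2)] by blast
    \<comment> \<open>For \<open>I = UNIV\<close> the sum of the axis components is \<open>z\<close>
      itself.\<close>
    then have "(\<Sum>i\<in>I. axis i (z $ i)) \<in> \<Lambda>" for I
      by (induction I rule: infinite_finite_induct) (auto simp: zero add)
    from this[of UNIV] show "z \<in> \<Lambda>"
      by (simp only: sum_axis vec_lambda_eta)
  qed
qed

text \<open>The witness is the subgroup of vectors with all coordinates divisible by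
  \<open>m\<close>. Its index is finite because reducing coordinates modulo \<open>m\<close> moves a
  representative of any coset into the finite box \<open>R\<close>.\<close>

lemma periodicI:
  fixes P :: "nat ^ 'a::finite \<Rightarrow> 'c"
  assumes "m > 0" and P: "\<And>x y. (\<And>i. x $ i mod m = y $ i mod m) \<Longrightarrow> P x = P y"
  shows "periodic P"
proof -
  define \<Lambda> :: "(int ^ 'a) set" where "\<Lambda> = {z. \<forall>i. int m dvd z $ i}"
  define R :: "(int ^ 'a) set" where "R = {v. \<forall>i. v $ i \<in> {0..<int m}}"
  have "subgroup \<Lambda> int_vec_group"
    by (auto simp: subgroup_int_vec_group_iff \<Lambda>_def)
  moreover have "rcosets\<^bsub>int_vec_group\<^esub> \<Lambda> \<subseteq> (\<lambda>v. \<Lambda> #>\<^bsub>int_vec_group\<^esub> v) ` R"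
  proof
    fix C assume "C \<in> rcosets\<^bsub>int_vec_group\<^esub> \<Lambda>"
    then obtain v where C: "C = \<Lambda> #>\<^bsub>int_vec_group\<^esub> v"
      by (auto simp: RCOSETS_def)
    define r :: "int ^ 'a" where "r = (\<chi> i. v $ i mod int m)"
    have "r \<in> R"
      using \<open>m > 0\<close> by (simp add: r_def R_def)
    have coset: "\<Lambda> #>\<^bsub>int_vec_group\<^esub> u = {z. \<forall>i. z $ i mod int m = u $ i mod int m}" for u
    proof -
      have "z \<in> \<Lambda> #>\<^bsub>int_vec_group\<^esub> u \<longleftrightarrow> z - u \<in> \<Lambda>" for z
        by (auto simp: r_coset_def intro!: bexI[of _ "z - u"])
      then show ?thesis
        by (auto simp: \<Lambda>_def mod_eq_dvd_iff)
    qed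
    have "C = \<Lambda> #>\<^bsub>int_vec_group\<^esub> r"
      unfolding C coset by (simp add: r_def)
    with \<open>r \<in> R\<close> show "C \<in> (\<lambda>v. \<Lambda> #>\<^bsub>int_vec_group\<^esub> v) ` R"
      by blast
  qed
  then have "finite (rcosets\<^bsub>int_vec_group\<^esub> \<Lambda>)"
    by (rule finite_subset) (simp add: R_def finite_vec_range del: atLeastLessThan_iff)
  moreover have "P x = P y" if "of_nat_vec x - of_nat_vec y \<in> \<Lambda>" for x y
  proof (rule P)
    fix i
    have "int (x $ i) mod int m = int (y $ i) mod int m"
      using that by (simp add: \<Lambda>_def mod_eq_dvd_iff)
    then show "x $ i mod m = y $ i mod m"
      by (metis of_nat_eq_iff of_nat_mod)
  qed
  ultimately show ?thesis
    unfolding periodic_def by blast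
qed

lemma linear_on_nat_vec_sum: "linear_on_nat_vec (\<lambda>x. \<Sum>i\<in>UNIV. of_nat (x $ i) *s c i)"
  unfolding linear_on_nat_vec_def
proof (intro exI conjI allI)
  show "Vector_Spaces.linear (*s) (*s) (\<lambda>x. \<Sum>i\<in>UNIV. x $ i *s c i)"
    by unfold_locales
      (simp_all add: vec_eq_iff algebra_simps sum.distrib sum_distrib_left sum_component)
qed simp

section \<open>The function computed by a recurrent processor\<close>

lemma final_state_append: "final_state M q (v @ w) = final_state M (final_state M q v) w"
  by (induction v arbitrary: q) auto

lemma total_output_append:
  "total_output M q (v @ w) = total_output M q v + total_output M (final_state M q v) w"
  by (induction v arbitrary: q) (auto simp: add.assoc)

lemma final_state_in_states:
  assumes "finite_processor M" "q \<in> states M"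
  shows "final_state M q w \<in> states M"
  using assms by (induction w arbitrary: q) (auto simp: finite_processor_def)

text \<open>Commutation of single transitions is only available on \<open>states M\<close>, so
  closure of the states is used throughout. One letter is first moved past a whole word; induction
  on \<open>v\<close> then moves the other letters.\<close>

lemma final_state_commute:
  assumes fin: "finite_processor M" and ab: "abelian_processor M" and q: "q \<in> states M"
  shows "final_state M q (v @ w) = final_state M q (w @ v)"
proof -
  have letter: "final_state M (transition M i q) u = transition M i (final_state M q u)"
    if "q \<in> states M" for i q u
    using that
  proof (induction u arbitrary: q)
    case (Cons j u)
    have "transition M j (transition M i q) = transition M i (transition M j q)"
      using ab Cons.prems by (auto simp: abelian_processor_def)
    then show ?case
      using Cons fin by (simp add: finite_processor_def)
  qed simp
  show ?thesis
    using q
  proof (induction v arbitrary: q)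
    case (Cons i v)
    then have "final_state M q ((i # v) @ w) = final_state M (final_state M q w) (i # v)"
      using fin letter[of q i w] Cons.IH[of "transition M i q"]
      by (simp add: finite_processor_def final_state_append)
    then show ?case
      by (simp add: final_state_append)
  qed simp
qed

text \<open>Pigeonhole makes the orbit under \<open>i\<close> run into a cycle, possibly after a
  tail. Recurrence leads from the cycle back to the initial state, and commutation carries the
  period of the cycle there.\<close>

lemma recurrent_letter_returns:
  assumes fin: "finite_processor M" and ab: "abelian_processor M" and rec: "recurrent_processor M"
  obtains p :: nat where "p > 0" "final_state M (initial M) (replicate p i) = initial M"
proof -
  let ?q = "initial M"
  define orbit where "orbit n = final_state M ?q (replicate n i)" for n
  have q: "?q \<in> states M"
    using fin by (simp add: finite_processor_def)
  have "range orbit \<subseteq> states M"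
    using final_state_in_states[OF fin q] by (auto simp: orbit_def)
  moreover have "finite (states M)"
    using fin by (simp add: finite_processor_def)
  ultimately have "\<not> inj orbit"
    using finite_subset finite_imageD infinite_UNIV_nat by blast
  then obtain a b where "a < b" and eq: "orbit a = orbit b"
    unfolding inj_def by (metis linorder_neqE_nat)
  obtain v where v: "final_state M (orbit a) v = ?q"
    using rec q \<open>range orbit \<subseteq> states M\<close> unfolding recurrent_processor_def by blast
  \<comment> \<open>The word \<open>replicate a i @ v\<close> is a loop at the initial state, so
    prefixing it changes nothing. Moved to the end, its first part completes \<open>b\<close>
    letters \<open>i\<close>, and \<open>orbit b = orbit a\<close> lets \<open>v\<close> lead
    home.\<close>
  have "final_state M ?q (replicate (b - a) i)
      = final_state M ?q ((replicate a i @ v) @ replicate (b - a) i)"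
    using v by (simp add: final_state_append orbit_def)
  also have "\<dots> = final_state M ?q (replicate (b - a) i @ (replicate a i @ v))"
    by (rule final_state_commute[OF fin ab q])
  also have "\<dots> = final_state M (orbit b) v"
    unfolding append_assoc[symmetric] replicate_add[symmetric] final_state_append orbit_def
    using \<open>a < b\<close> by simp
  also have "\<dots> = ?q"
    using v eq by simp
  finally show ?thesis
    using that[of "b - a"] \<open>a < b\<close> by simp
qed

text \<open>A word for \<open>x\<close> extends to a word for \<open>y\<close> by appending letters,
  which can only add output.\<close>

lemma computes_mono:
  fixes M :: "('q, 'a::finite, 'b::finite) processor"
  assumes "computes M f"
  shows "mono f"
proof
  fix x y :: "nat ^ 'a"
  assume "x \<le> y"
  obtain v w where "letter_counts v = x" "letter_counts w = y - x"
    using surj_letter_counts by meson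
  moreover from this have "letter_counts (v @ w) = y"
    using vec_le_add_diff[OF \<open>x \<le> y\<close>] by (simp add: letter_counts_append)
  ultimately have "f y = f x + total_output M (final_state M (initial M) v) w"
    using assms total_output_append unfolding computes_def by metis
  then show "f x \<le> f y"
    by (simp add: less_eq_vec_def)
qed

lemma recurrent_quasi_additive:
  fixes M :: "('q, 'a::finite, 'b::finite) processor"
  assumes fin: "finite_processor M" and ab: "abelian_processor M" and rec: "recurrent_processor M"
    and comp: "computes M f"
  obtains m :: nat where "m > 0" "\<And>i x. f (axis i m + x) = f (axis i m) + f x"
proof -
  let ?q = "initial M"
  have "\<exists>p>0. final_state M ?q (replicate p i) = ?q" for i
    using recurrent_letter_returns[OF fin ab rec] by metis
  then obtain p where p: "\<And>i. p i > 0" "\<And>i. final_state M ?q (replicate (p i) i) = ?q"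
    by metis
  \<comment> \<open>A common multiple of the return times, so that one \<open>m\<close> serves every
    letter.\<close>
  define m where "m = (\<Prod>i\<in>UNIV. p i)"
  have mult: "final_state M ?q (replicate (p i * n) i) = ?q" for i n
    by (induction n) (simp_all add: replicate_add final_state_append p)
  have "final_state M ?q (replicate m i) = ?q" for i
  proof -
    have "p i dvd m"
      by (simp add: m_def dvd_prodI)
    then show ?thesis
      using mult by auto
  qed
  \<comment> \<open>Having read \<open>m\<close> letters \<open>i\<close>, the processor is back in
    its initial state and treats a word for \<open>x\<close> as if started afresh.\<close>
  then have "f (axis i m + x) = f (axis i m) + f x" for i x
    using comp total_output_append surj_letter_counts[of x] letter_counts_append letter_counts_replicate
    unfolding computes_def by metis
  moreover have "m > 0"
    using p(1) by (simp add: m_def prod_pos)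
  ultimately show ?thesis
    using that by blast
qed

lemma quasi_additive_imp_linear_plus_periodic:
  fixes f :: "nat ^ 'a::finite \<Rightarrow> nat ^ 'b::finite"
  assumes "m > 0" and step: "\<And>i x. f (axis i m + x) = f (axis i m) + f x"
  obtains L P :: "nat ^ 'a \<Rightarrow> rat ^ 'b"
  where "linear_on_nat_vec L" "periodic P" "\<And>x. of_nat_vec (f x) = L x + P x"
proof -
  \<comment> \<open>The average output per letter \<open>i\<close> over a block of \<open>m\<close>
    such letters; this choice makes \<open>L\<close> agree with \<open>f\<close> on
    \<open>axis i m\<close>.\<close>
  define c :: "'a \<Rightarrow> rat ^ 'b" where "c i = (1 / of_nat m) *s of_nat_vec (f (axis i m))" for i
  define L where "L x = (\<Sum>i\<in>UNIV. of_nat (x $ i) *s c i)" for x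
  define P where "P x = of_nat_vec (f x) - L x" for x
  have L_add: "L (x + y) = L x + L y" for x y
    by (simp add: L_def vector_sadd_rdistrib sum.distrib)
  have L_axis: "L (axis i m) = of_nat_vec (f (axis i m))" for i
  proof -
    have "L (axis i m) = (\<Sum>j\<in>UNIV. if j = i then of_nat m *s c i else 0)"
      unfolding L_def by (rule sum.cong) (auto simp: axis_def)
    then show ?thesis
      using \<open>m > 0\<close> by (simp add: c_def)
  qed
  have P_step: "P (axis i m + x) = P x" for i x
    by (simp add: P_def step L_add L_axis of_nat_vec_add)
  have P_steps: "P (axis i (m * n) + x) = P x" for i n x
  proof (induction n)
    case (Suc n)
    have "axis i (m * Suc n) + x = axis i m + (axis i (m * n) + x)"
      by (simp add: vec_eq_iff axis_def)
    then show ?case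
      by (simp add: P_step Suc)
  qed simp
  have P_sum: "P ((\<Sum>i\<in>I. axis i (m * n i)) + x) = P x" for I n x
    by (induction I rule: infinite_finite_induct) (simp_all add: P_steps add.assoc)
  have P_mod: "P x = P (\<chi> i. x $ i mod m)" for x
  proof -
    \<comment> \<open>Division with remainder in each coordinate; the quotient part is invisible to
      \<open>P\<close> by \<open>P_sum\<close>.\<close>
    have "x = (\<Sum>i\<in>UNIV. axis i (m * (x $ i div m))) + (\<chi> i. x $ i mod m)"
      by (simp add: sum_axis vec_eq_iff)
    then show ?thesis
      using P_sum by metis
  qed
  have "periodic P"
  proof (rule periodicI[OF \<open>m > 0\<close>])
    fix x y :: "nat ^ 'a"
    assume "\<And>i. x $ i mod m = y $ i mod m"
    then show "P x = P y"
      using P_mod[of x] P_mod[of y] by simp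
  qed
  moreover have "linear_on_nat_vec L"
    unfolding L_def by (rule linear_on_nat_vec_sum)
  ultimately show ?thesis
    using that by (simp add: P_def)
qed

section \<open>The processor emitting the increments of a function\<close>

lemma periodic_increments_imp_computable:
  fixes f :: "nat ^ 'a::finite \<Rightarrow> nat ^ 'b::finite"
  assumes "m > 0" and zero: "f 0 = 0" and "mono f"
    and incr: "\<And>x i. f (x + axis i 1) - f x =
      f ((\<chi> a. x $ a mod m) + axis i 1) - f (\<chi> a. x $ a mod m)"
  shows "computable_by_recurrent f"
proof -
  define red :: "nat ^ 'a \<Rightarrow> nat ^ 'a" where "red x = (\<chi> a. x $ a mod m)" for x
  define M where "M = \<lparr>states = range red, transition = (\<lambda>i q. red (q + axis i 1)),
    emission = (\<lambda>i q. f (q + axis i 1) - f q), initial = 0\<rparr>"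
  have M: "states M = range red" "transition M i q = red (q + axis i 1)"
    "emission M i q = f (q + axis i 1) - f q" "initial M = 0" for i q
    by (simp_all add: M_def)
  have red_add: "red (red x + y) = red (x + y)" for x y
    by (simp add: red_def vec_eq_iff mod_add_left_eq)
  have red_0: "red 0 = 0"
    by (simp add: red_def vec_eq_iff)
  \<comment> \<open>This is where \<open>incr\<close> enters: the increment of \<open>f\<close> at
    \<open>x\<close> can be read off from the state \<open>red x\<close>.\<close>
  have emit: "emission M i (red x) = emission M i x" for i x
    using incr[of x i] by (simp add: M red_def)
  \<comment> \<open>Subtraction on naturals truncates; monotonicity of \<open>f\<close> makes the
    difference exact.\<close>
  have f_emit: "f x + emission M i x = f (x + axis i 1)" for i x
    unfolding M by (rule vec_le_add_diff, rule monoD[OF \<open>mono f\<close>]) (simp add: less_eq_vec_def)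
  have state: "final_state M (red x) w = red (x + letter_counts w)" for x w
    by (induction w arbitrary: x) (simp_all add: M letter_counts_Cons red_add add.assoc)
  \<comment> \<open>The emitted increments telescope. The true count \<open>x\<close> is carried
    along beside the state \<open>red x\<close>, since the state alone does not determine the value
    of \<open>f\<close>.\<close>
  have out: "f x + total_output M (red x) w = f (x + letter_counts w)" for x w
  proof (induction w arbitrary: x)
    case (Cons i w)
    have "f x + total_output M (red x) (i # w)
        = f (x + axis i 1) + total_output M (red (x + axis i 1)) w"
      by (simp add: emit M(2) red_add f_emit flip: add.assoc)
    then show ?case
      by (simp add: Cons letter_counts_Cons add.assoc)
  qed simp
  have rec: "\<exists>w. final_state M (red x) w = red y" for x y
  proof -
    \<comment> \<open>The second summand fills every coordinate of \<open>red x\<close> up to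
      \<open>m\<close>, which amounts to a reset; then \<open>y\<close> is read.\<close>
    obtain w where "letter_counts w = y + (\<chi> a. m - x $ a mod m)"
      using surj_letter_counts by blast
    moreover have "red (red x + (y + (\<chi> a. m - x $ a mod m))) = red y"
    proof -
      have sum: "x $ a mod m + (y $ a + (m - x $ a mod m)) = y $ a + m" for a
        using mod_less_divisor[OF \<open>m > 0\<close>, of "x $ a"] by linarith
      then show ?thesis
        by (simp only: red_def vec_eq_iff vec_lambda_beta vector_add_component sum mod_add_self2 simp_thms)
    qed
    ultimately show ?thesis
      using state[of x w] red_add by metis
  qed
  show ?thesis
  proof (rule computable_by_recurrentI)
    have "range red \<subseteq> {v. \<forall>i. v $ i \<in> {..<m}}"
      using \<open>m > 0\<close> by (auto simp: red_def)
    then have "finite (range red)"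
      by (rule finite_subset) (simp add: finite_vec_range del: lessThan_iff)
    moreover have "0 \<in> range red"
      using red_0 by (metis rangeI)
    ultimately show "finite_processor M"
      using rec[of 0] unfolding finite_processor_def M red_0 by blast
    have "emission M i (red x) + emission M j (transition M i (red x)) =
      emission M j (red x) + emission M i (transition M j (red x))" for i j x
    proof -
      \<comment> \<open>After adding \<open>f x\<close>, either order of the two letters gives the
        same value of \<open>f\<close>; cancelling \<open>f x\<close> gives the abelian law.\<close>
      have "f x + (emission M i (red x) + emission M j (transition M i (red x)))
          = f (x + axis i 1 + axis j 1)" for i j
        by (simp only: M(2) red_add emit f_emit flip: add.assoc)
      then have "f x + (emission M i (red x) + emission M j (transition M i (red x)))
          = f x + (emission M j (red x) + emission M i (transition M j (red x)))"
        by (simp only: add.assoc add.commute[of "axis i 1"])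
      then show ?thesis
        by simp
    qed
    moreover have "transition M i (transition M j (red x)) = transition M j (transition M i (red x))"
      for i j x
      by (simp only: M(2) red_add) (simp only: ac_simps)
    ultimately show "abelian_processor M"
      unfolding abelian_processor_def M(1) by blast
    show "recurrent_processor M"
      using rec unfolding recurrent_processor_def M(1) by blast
    show "computes M f"
      using out[of 0] by (simp add: computes_def zero M(4) red_0)
  qed
qed

section \<open>Increments of a linear plus periodic function\<close>

lemma linear_plus_periodic_imp_periodic_increments:
  fixes f :: "nat ^ 'a::finite \<Rightarrow> nat ^ 'b::finite" and L P :: "nat ^ 'a \<Rightarrow> rat ^ 'b"
  assumes "linear_on_nat_vec L" "periodic P" and f: "\<And>x. of_nat_vec (f x) = L x + P x"
  obtains m where "m > 0"
    "\<And>x i. f (x + axis i 1) - f x = f ((\<chi> a. x $ a mod m) + axis i 1) - f (\<chi> a. x $ a mod m)"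
proof -
  obtain L' where L': "Vector_Spaces.linear (*s) (*s) L'" "\<And>x. L x = L' (of_nat_vec x)"
    using assms(1) by (auto simp: linear_on_nat_vec_def)
  have L_add: "L (x + y) = L x + L y" for x y
    using module_hom.add[OF Vector_Spaces.linear.axioms(3)[OF L'(1)]] by (simp add: L'(2) of_nat_vec_add)
  obtain \<Lambda> where "subgroup \<Lambda> int_vec_group" "finite (rcosets\<^bsub>int_vec_group\<^esub> \<Lambda>)"
    and P: "\<And>x y. of_nat_vec x - of_nat_vec y \<in> \<Lambda> \<Longrightarrow> P x = P y"
    using assms(2) unfolding periodic_def by blast
  then obtain m where m: "m > 0" "\<And>z. (\<And>i. int m dvd z $ i) \<Longrightarrow> z \<in> \<Lambda>"
    using finite_index_contains_multiples by metis
  have "f (x + axis i 1) - f x = f ((\<chi> a. x $ a mod m) + axis i 1) - f (\<chi> a. x $ a mod m)" for x i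
  proof -
    define r where "r = (\<chi> a. x $ a mod m)"
    \<comment> \<open>The two arguments differ by \<open>x - r\<close>, whose coordinates are
      multiples of \<open>m\<close>.\<close>
    have "P (x + y) = P (r + y)" for y
      by (rule P, rule m(2)) (simp add: r_def of_nat_mod minus_mod_eq_mult_div)
    from this[of 0] this[of "axis i 1"]
    \<comment> \<open>Equality of increments is stated with sums, so that the cast from naturals is
      respected: the linear parts agree by additivity and the periodic parts by the previous
      step.\<close>
    have "(of_nat_vec (f (x + axis i 1) + f r) :: rat ^ 'b) = of_nat_vec (f (r + axis i 1) + f x)"
      by (simp add: f L_add of_nat_vec_add)
    then have eq: "f (x + axis i 1) + f r = f (r + axis i 1) + f x"
      by (simp only: of_nat_vec_eq_iff)
    \<comment> \<open>Equal sums give equal natural differences even where these truncate to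
      0.\<close>
    have "f (x + axis i 1) $ j - f x $ j = f (r + axis i 1) $ j - f r $ j" for j
      using arg_cong[OF eq, of "\<lambda>v. v $ j"] unfolding vector_add_component by linarith
    then show ?thesis
      by (simp add: vec_eq_iff r_def)
  qed
  then show ?thesis
    using that m(1) by blast
qed

theorem theorem2p5:
  fixes f :: "nat ^ 'a::finite \<Rightarrow> nat ^ 'b::finite"
  shows "computable_by_recurrent f \<longleftrightarrow>
    f 0 = 0 \<and>
    mono f \<and>
    (\<exists>(L :: nat ^ 'a \<Rightarrow> rat ^ 'b) (P :: nat ^ 'a \<Rightarrow> rat ^ 'b).
       linear_on_nat_vec L \<and> periodic P \<and> (\<forall>x. of_nat_vec (f x) = L x + P x))"
proof
  assume "computable_by_recurrent f"
  then obtain M :: "(nat, 'a, 'b) processor" where M: "finite_processor M" "abelian_processor M"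
    "recurrent_processor M" "computes M f"
    unfolding computable_by_recurrent_def by blast
  from M obtain m where "m > 0" "\<And>i x. f (axis i m + x) = f (axis i m) + f x"
    by (rule recurrent_quasi_additive) (rule that)
  then obtain L P :: "nat ^ 'a \<Rightarrow> rat ^ 'b"
    where "linear_on_nat_vec L" "periodic P" "\<And>x. of_nat_vec (f x) = L x + P x"
    by (rule quasi_additive_imp_linear_plus_periodic) (rule that)
  \<comment> \<open>The empty word has count vector 0 and output 0.\<close>
  moreover have "f 0 = 0"
    using M(4)[unfolded computes_def, rule_format, of "[]"] by simp
  ultimately show "f 0 = 0 \<and> mono f \<and> (\<exists>L P :: nat ^ 'a \<Rightarrow> rat ^ 'b.
      linear_on_nat_vec L \<and> periodic P \<and> (\<forall>x. of_nat_vec (f x) = L x + P x))"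
    using computes_mono[OF M(4)] by blast
next
  assume "f 0 = 0 \<and> mono f \<and> (\<exists>L P :: nat ^ 'a \<Rightarrow> rat ^ 'b.
      linear_on_nat_vec L \<and> periodic P \<and> (\<forall>x. of_nat_vec (f x) = L x + P x))"
  then obtain L P :: "nat ^ 'a \<Rightarrow> rat ^ 'b" where "f 0 = 0" "mono f"
    "linear_on_nat_vec L" "periodic P" "\<And>x. of_nat_vec (f x) = L x + P x"
    by blast
  moreover from this(3-5) obtain m where "m > 0" "\<And>x i. f (x + axis i 1) - f x =
      f ((\<chi> a. x $ a mod m) + axis i 1) - f (\<chi> a. x $ a mod m)"
    by (rule linear_plus_periodic_imp_periodic_increments) (rule that)
  ultimately show "computable_by_recurrent f"
    by (intro periodic_increments_imp_computable)
qed

end
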